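(* Let $(\Omega,\Sigma,P)$ be a probability space, $N$ a random variable on $\Omega$ with values in a set $R_N\subseteq\mathbb N_0$ containing $0$, with $P(N=n)>0$ for all $n\in R_N$, and $\Theta$ a $d$-dimensional random vector on $\Omega$ with values in $D\subseteq\mathbb R^d$, such that there is a regular conditional probability $\{P_\theta\}_{\theta\in D}$ of $P$ over $P_\Theta$ consistent with $\Theta$. Let $a,b:D\to\mathbb R$ be $\mathfrak B(D)$-measurable and suppose that $P_N\in\mathbf{Panjer}(a(\Theta),b(\Theta);0)$. Write $p_n:=P(N=n)$. Then the family $\{\mu_n\}_{n\in R_N}$ of probability measures on $\Sigma$ defined by $$\mu_n(A):=\frac{\mathbb E_P[\mathbf 1_A\cdot\mathbf 1_{\{N=n\}}]}{\mathbb E_P[\mathbf 1_{\{N=n\}}]}\quad\text{for any }A\in\Sigma$$ is a regular conditional probability of $P$ over $P_N$ consistent with $N$, and for any $n\in R_N\setminus\{0\}$ $$p_n=C_n\cdot p_{n-1},\qquad\text{where}\quad C_n:=\mathbb E_{\mu_{n-1}}\Big[a(\Theta)+\frac{b(\Theta)}{n}\Big].$$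
   Context: $\mathbb N_0=\{0,1,2,\dots\}$. $\mathfrak B(D)$ is the Borel $\sigma$-algebra of $D$. $P_\Theta$ is the distribution of $\Theta$ on $(D,\mathfrak B(D))$ and $P_N$ the distribution of $N$ on $(R_N,\mathcal P(R_N))$, with $\mathcal P(R_N)$ the power set. $P_N\in\mathbf{Panjer}(a(\Theta),b(\Theta);0)$ means that for every $n\in R_N\setminus\{0\}$, $P(N=n\mid\Theta)=\big(a(\Theta)+\frac{b(\Theta)}{n}\big)\cdot P(N=n-1\mid\Theta)$ $P$-almost surely. For a probability space $(Y,T,Q)$, a family $\{P_y\}_{y\in Y}$ of probability measures on $\Sigma$ is a regular conditional probability of $P$ over $Q$ if (d1) for each $E\in\Sigma$ the map $y\mapsto P_y(E)$ is $T$-measurable and (d2) $\int P_y(E)\,Q(dy)=P(E)$ for each $E\in\Sigma$. If $f:\Omega\to Y$ is measurable with $P(f^{-1}[B])=Q(B)$ for each $B\in T$, the family is consistent with $f$ if for each $B\in T$, $P_y(f^{-1}[B])=1$ for $Q$-almost all $y\in B$. *)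

theory Defs
  imports "HOL-Probability.Probability"
begin

definition regular_cond_prob :: "'a measure \<Rightarrow> 'b measure \<Rightarrow> ('b \<Rightarrow> 'a measure) \<Rightarrow> bool" where
  "regular_cond_prob P Q K \<longleftrightarrow>
     prob_space P \<and> prob_space Q \<and>
     (\<forall>y\<in>space Q. prob_space (K y) \<and> sets (K y) = sets P) \<and>
     (\<forall>E\<in>sets P. (\<lambda>y. measure (K y) E) \<in> borel_measurable Q) \<and>
     (\<forall>E\<in>sets P. (\<integral>y. measure (K y) E \<partial>Q) = measure P E)"

text \<open>Consistency is only meaningful for a map \<open>f\<close> whose law under \<open>P\<close> is \<open>Q\<close>;
  this is made part of the predicate.\<close>

definition consistent_with ::
    "'a measure \<Rightarrow> 'b measure \<Rightarrow> ('b \<Rightarrow> 'a measure) \<Rightarrow> ('a \<Rightarrow> 'b) \<Rightarrow> bool" where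
  "consistent_with P Q K f \<longleftrightarrow>
     f \<in> measurable P Q \<and>
     (\<forall>B\<in>sets Q. measure P (f -` B \<inter> space P) = measure Q B) \<and>
     (\<forall>B\<in>sets Q. AE y in Q. y \<in> B \<longrightarrow> measure (K y) (f -` B \<inter> space P) = 1)"

text \<open>\<open>P(N = n | \<Theta>)\<close>: the conditional expectation of the indicator of \<open>{N = n}\<close> given
  the \<open>\<sigma>\<close>-algebra generated by \<open>\<Theta>\<close>, where \<open>\<Theta>\<close> takes values in the measurable space \<open>S\<close>.\<close>

definition cond_prob_eq ::
    "'a measure \<Rightarrow> ('a \<Rightarrow> nat) \<Rightarrow> nat \<Rightarrow> 'b measure \<Rightarrow> ('a \<Rightarrow> 'b) \<Rightarrow> 'a \<Rightarrow> real" where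
  "cond_prob_eq P N n S \<Theta> =
     real_cond_exp P (vimage_algebra (space P) \<Theta> S) (indicator {\<omega>\<in>space P. N \<omega> = n})"

definition mixed_panjer_0 ::
    "'a measure \<Rightarrow> ('a \<Rightarrow> nat) \<Rightarrow> nat set \<Rightarrow> 'b measure \<Rightarrow> ('a \<Rightarrow> 'b) \<Rightarrow>
     ('b \<Rightarrow> real) \<Rightarrow> ('b \<Rightarrow> real) \<Rightarrow> bool" where
  "mixed_panjer_0 P N R S \<Theta> a b \<longleftrightarrow>
     (\<forall>n\<in>R - {0}. AE \<omega> in P.
        cond_prob_eq P N n S \<Theta> \<omega> =
          (a (\<Theta> \<omega>) + b (\<Theta> \<omega>) / real n) * cond_prob_eq P N (n - 1) S \<Theta> \<omega>)"

text \<open>If the set function below were not countably additive, \<open>measure_of\<close> would yield the zero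
  measure, so asserting that \<open>cond_on_value P N n\<close> is a probability measure includes the claim
  that the formula defines one.\<close>

definition cond_on_value :: "'a measure \<Rightarrow> ('a \<Rightarrow> nat) \<Rightarrow> nat \<Rightarrow> 'a measure" where
  "cond_on_value P N n = measure_of (space P) (sets P)
     (\<lambda>A. ennreal (
        (\<integral>\<omega>. indicator A \<omega> * indicator {\<omega>\<in>space P. N \<omega> = n} \<omega> \<partial>P) /
        (\<integral>\<omega>. indicator {\<omega>\<in>space P. N \<omega> = n} \<omega> \<partial>P)))"

end

theory Submission
  imports Defs
begin

text \<open>
  Conditioning on \<open>\<Theta>\<close> moves the \<open>\<Theta>\<close>-measurable factor \<open>c = a(\<Theta>) + b(\<Theta>)/n\<close> in and out of
  expectations, so integrating \<open>P(N = n | \<Theta>) = c P(N = n - 1 | \<Theta>)\<close> gives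
  \<open>P(N = n) = E[c 1\<^bsub>N = n - 1\<^esub>] = p\<^bsub>n - 1\<^esub> C\<^sub>n\<close>. No integrability of \<open>c\<close> is assumed: since
  indicators are nonnegative, integrability of \<open>c 1\<^bsub>N = n - 1\<^esub>\<close> can be recovered from that of
  \<open>c P(N = n - 1 | \<Theta>) = P(N = n | \<Theta>)\<close>.
\<close>

text \<open>\<open>real_cond_exp\<close> is the difference of the \<open>enn2real\<close> images of
  the nonnegative conditional expectations of \<open>g\<close> and \<open>- g\<close>. The second
  vanishes almost everywhere because \<open>ennreal\<close> truncates \<open>- g\<close> to 0. The
  first has the finite integral of \<open>g\<close>, so it is almost everywhere finite and
  \<open>enn2real\<close> loses nothing.\<close>

lemma (in sigma_finite_subalgebra) AE_nn_cond_exp_eq_real_cond_exp: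
  assumes int: "integrable M g" and nonneg: "\<And>x. x \<in> space M \<Longrightarrow> 0 \<le> g x"
  shows "AE x in M. nn_cond_exp M F (\<lambda>x. ennreal (g x)) x = ennreal (real_cond_exp M F g x)"
proof -
  have [measurable]: "g \<in> borel_measurable M"
    using int by auto
  have "(\<integral>\<^sup>+ x. nn_cond_exp M F (\<lambda>x. ennreal (g x)) x \<partial>M) = (\<integral>\<^sup>+ x. ennreal (g x) \<partial>M)"
    using nn_cond_exp_intg[of "\<lambda>_. 1" "\<lambda>x. ennreal (g x)"] by simp
  also have "\<dots> \<noteq> \<infinity>"
    using nn_integral_eq_integral[OF int] nonneg by simp
  finally have finite: "AE x in M. nn_cond_exp M F (\<lambda>x. ennreal (g x)) x \<noteq> \<infinity>"
    by (intro nn_integral_PInf_AE) auto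
  have "AE x in M. ennreal (- g x) = 0"
    using nonneg by (auto simp: ennreal_neg)
  then have "AE x in M. nn_cond_exp M F (\<lambda>x. ennreal (- g x)) x = nn_cond_exp M F (\<lambda>_. 0) x"
    by (rule nn_cond_exp_cong) auto
  moreover have "AE x in M. 0 = nn_cond_exp M F (\<lambda>_. 0) x"
    by (rule nn_cond_exp_F_meas) auto
  ultimately have "AE x in M. nn_cond_exp M F (\<lambda>x. ennreal (- g x)) x = 0"
    by eventually_elim simp
  with finite show ?thesis
    by eventually_elim (simp add: real_cond_exp_def less_top)
qed

text \<open>This supplies the integrability that the pull-out rule \<open>real_cond_exp_intg\<close>
  presupposes. For nonnegative integrands pulling out needs no integrability, so
  \<open>\<bar>f\<bar> * g\<close> and \<open>\<bar>f\<bar>\<close> times the conditional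
  expectation of \<open>g\<close> have the same integral in \<open>ennreal\<close>. For signed
  \<open>g\<close> the claim can fail, since cancellation inside the conditional expectation may
  hide a divergent integral.\<close>

lemma (in sigma_finite_subalgebra) integrable_mult_real_cond_expD:
  fixes f g :: "'a \<Rightarrow> real"
  assumes int: "integrable M g" and nonneg: "\<And>x. x \<in> space M \<Longrightarrow> 0 \<le> g x"
    and f [measurable]: "f \<in> borel_measurable F"
    and int_cond: "integrable M (\<lambda>x. f x * real_cond_exp M F g x)"
  shows "integrable M (\<lambda>x. f x * g x)"
proof (rule integrableI_bounded)
  have [measurable]: "g \<in> borel_measurable M"
    using int by auto
  have [measurable]: "f \<in> borel_measurable M"
    using measurable_from_subalg[OF subalg f] .
  show "(\<lambda>x. f x * g x) \<in> borel_measurable M"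
    by simp
  have "(\<integral>\<^sup>+ x. ennreal (norm (f x * g x)) \<partial>M) = (\<integral>\<^sup>+ x. ennreal \<bar>f x\<bar> * ennreal (g x) \<partial>M)"
    using nonneg by (intro nn_integral_cong) (simp add: abs_mult ennreal_mult)
  also have "\<dots> = (\<integral>\<^sup>+ x. ennreal \<bar>f x\<bar> * nn_cond_exp M F (\<lambda>x. ennreal (g x)) x \<partial>M)"
    by (rule nn_cond_exp_intg[symmetric]) auto
  \<comment> \<open>Passing to the absolute value of the conditional expectation only increases the
    integrand, so its sign need not be determined.\<close>
  also have "\<dots> \<le> (\<integral>\<^sup>+ x. ennreal (norm (f x * real_cond_exp M F g x)) \<partial>M)"
  proof (rule nn_integral_mono_AE)
    show "AE x in M. ennreal \<bar>f x\<bar> * nn_cond_exp M F (\<lambda>x. ennreal (g x)) x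
        \<le> ennreal (norm (f x * real_cond_exp M F g x))"
      using AE_nn_cond_exp_eq_real_cond_exp[OF int nonneg, simplified]
      by eventually_elim
        (simp add: abs_mult ennreal_mult ennreal_leI mult_left_mono)
  qed
  also have "\<dots> < \<infinity>"
    using int_cond by (simp add: integrable_iff_bounded)
  finally show "(\<integral>\<^sup>+ x. ennreal (norm (f x * g x)) \<partial>M) < \<infinity>" .
qed

text \<open>The density in \<open>uniform_measure_def\<close> is a quotient in
  \<open>ennreal\<close>; a real-valued density is the form to which
  \<open>integrable_density\<close> and \<open>integral_density\<close> apply.\<close>

lemma (in finite_measure) uniform_measure_eq_density_real:
  assumes "0 < measure M A"
  shows "uniform_measure M A = density M (\<lambda>x. ennreal (indicator A x / measure M A))"
  using assms unfolding uniform_measure_def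
  by (intro arg_cong[where f = "density M"] ext)
    (simp add: emeasure_eq_measure divide_ennreal flip: ennreal_1 split: split_indicator)

lemma (in finite_measure)
  fixes f :: "'a \<Rightarrow> real"
  assumes A: "0 < measure M A" and f [measurable]: "f \<in> borel_measurable M"
  shows integrable_uniform_measure_iff:
      "integrable (uniform_measure M A) f \<longleftrightarrow> integrable M (\<lambda>x. f x * indicator A x)"
    and integral_uniform_measure:
      "integral\<^sup>L (uniform_measure M A) f = (\<integral>x. f x * indicator A x \<partial>M) / measure M A"
proof -
  \<comment> \<open>\<open>measure\<close> is 0 outside the \<sigma>-algebra, so positive measure
    already yields measurability.\<close>
  have [measurable]: "A \<in> sets M"
    using A measure_notin_sets[of A M] by fastforce
  have eq: "(\<lambda>x. (indicator A x / measure M A) *\<^sub>R f x) = (\<lambda>x. inverse (measure M A) * (f x * indicator A x))"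
    by (simp add: field_simps)
  show "integrable (uniform_measure M A) f \<longleftrightarrow> integrable M (\<lambda>x. f x * indicator A x)"
    unfolding uniform_measure_eq_density_real[OF A]
    by (subst integrable_density) (use A in \<open>auto simp del: real_scaleR_def simp: eq\<close>)
  show "integral\<^sup>L (uniform_measure M A) f = (\<integral>x. f x * indicator A x \<partial>M) / measure M A"
    unfolding uniform_measure_eq_density_real[OF A]
    by (subst integral_density) (use A in \<open>auto simp del: real_scaleR_def simp: eq inverse_eq_divide\<close>)
qed

text \<open>On measurable sets the quotient of integrals agrees with the values of an existing
  measure. Countability of additivity is thereby inherited, and \<open>measure_of\<close> does not
  fall back to the zero measure.\<close>

lemma (in prob_space) cond_on_value_eq_uniform_measure:
  assumes "0 < prob {\<omega> \<in> space M. N \<omega> = n}"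
  shows "cond_on_value M N n = uniform_measure M {\<omega> \<in> space M. N \<omega> = n}" (is "_ = uniform_measure M ?S")
proof -
  have [measurable]: "?S \<in> sets M"
    using assms measure_notin_sets[of ?S M] by fastforce
  have "cond_on_value M N n = measure_of (space M) (sets M) (emeasure (uniform_measure M ?S))"
    unfolding cond_on_value_def
  proof (rule measure_of_eq)
    show "sets M \<subseteq> Pow (space M)"
      by (rule sets.space_closed)
    fix A assume "A \<in> sigma_sets (space M) (sets M)"
    then have [measurable]: "A \<in> sets M"
      by (simp add: sets.sigma_sets_eq)
    have "(\<integral>\<omega>. indicator A \<omega> * indicator ?S \<omega> \<partial>M) = prob (?S \<inter> A)"
      by (simp add: indicator_inter_arith[symmetric] Int_commute)
    then show "ennreal ((\<integral>\<omega>. indicator A \<omega> * indicator ?S \<omega> \<partial>M) / (\<integral>\<omega>. indicator ?S \<omega> \<partial>M)) =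
        emeasure (uniform_measure M ?S) A"
      using assms by (simp add: emeasure_eq_measure divide_ennreal)
  qed
  also have "\<dots> = uniform_measure M ?S"
    using measure_of_of_measure[of "uniform_measure M ?S"] by simp
  finally show ?thesis .
qed

text \<open>The averaging property is the law of total probability over the countable partition of
  the space into the events \<open>{N = n}\<close>. Measurability in \<open>n\<close> is automatic
  on a discrete space.\<close>

lemma (in prob_space) regular_cond_prob_cond_on_value:
  assumes N [measurable]: "N \<in> measurable M (count_space R)"
    and pos: "\<And>n. n \<in> R \<Longrightarrow> 0 < prob {\<omega> \<in> space M. N \<omega> = n}"
  shows "regular_cond_prob M (distr M (count_space R) N) (cond_on_value M N)"
proof -
  let ?Q = "distr M (count_space R) N"
  let ?S = "\<lambda>n. {\<omega> \<in> space M. N \<omega> = n}"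
  have S [measurable]: "?S n \<in> sets M" if "n \<in> R" for n
    using pos[OF that] measure_notin_sets[of "?S n" M] by fastforce
  have K: "cond_on_value M N n = uniform_measure M (?S n)" if "n \<in> R" for n
    using cond_on_value_eq_uniform_measure pos[OF that] .
  have cond: "measure (cond_on_value M N n) E = prob (?S n \<inter> E) / prob (?S n)"
    if "n \<in> R" "E \<in> sets M" for n E
    using that pos[OF that(1)] by (simp add: K emeasure_eq_measure)
  \<comment> \<open>Writing the law of \<open>N\<close> as a density turns integration over
    \<open>?Q\<close> into a weighted sum over \<open>R\<close>.\<close>
  have Q: "?Q = density (count_space R) (\<lambda>n. ennreal (prob (?S n)))"
  proof (rule measure_eqI_countable)
    show "emeasure ?Q {n} = emeasure (density (count_space R) (\<lambda>n. ennreal (prob (?S n)))) {n}"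
      if n: "n \<in> R" for n
    proof -
      have "N -` {n} \<inter> space M = ?S n"
        by auto
      then show ?thesis
        using n by (simp add: emeasure_distr emeasure_density emeasure_eq_measure
            nn_integral_count_space_indicator[symmetric] nn_integral_count_space'[of "{n}"])
    qed
  qed auto
  have total: "(\<integral>n. measure (cond_on_value M N n) E \<partial>?Q) = prob E" if E [measurable]: "E \<in> sets M" for E
  proof (rule integral_eq_nn_integral[THEN trans])
    have "(\<integral>\<^sup>+ n. ennreal (measure (cond_on_value M N n) E) \<partial>?Q) =
        (\<integral>\<^sup>+ n. emeasure M (?S n \<inter> E) \<partial>count_space R)"
      unfolding Q
    proof (subst nn_integral_density)
      \<comment> \<open>Each weight \<open>P(N = n)\<close> cancels the denominator of the
        conditional probability; positivity on \<open>R\<close> allows this.\<close>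
      show "(\<integral>\<^sup>+ n. ennreal (prob (?S n)) * ennreal (measure (cond_on_value M N n) E) \<partial>count_space R) =
          (\<integral>\<^sup>+ n. emeasure M (?S n \<inter> E) \<partial>count_space R)"
        using pos by (intro nn_integral_cong)
          (auto simp: cond E emeasure_eq_measure ennreal_mult[symmetric] less_imp_neq[symmetric])
    qed auto
    also have "\<dots> = emeasure M (\<Union>n\<in>R. ?S n \<inter> E)"
      by (intro emeasure_UN_countable[symmetric]) (auto simp: disjoint_family_on_def)
    also have "(\<Union>n\<in>R. ?S n \<inter> E) = E"
      using sets.sets_into_space[OF E] measurable_space[OF N] by auto
    finally show "enn2real (\<integral>\<^sup>+ n. ennreal (measure (cond_on_value M N n) E) \<partial>?Q) = prob E"
      by (simp add: measure_def)
  qed auto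
  have "prob_space (cond_on_value M N n) \<and> sets (cond_on_value M N n) = sets M" if "n \<in> R" for n
    using pos[OF that] by (auto simp: K that emeasure_eq_measure intro!: prob_space_uniform_measure)
  then show ?thesis
    unfolding regular_cond_prob_def
    using total prob_space_axioms by (auto intro: prob_space_distr)
qed

text \<open>If \<open>n\<close> lies in \<open>B\<close>, then \<open>{N = n}\<close> is contained
  in the preimage of \<open>B\<close>, which therefore has conditional probability one. This holds
  for every such \<open>n\<close>, with no exceptional null set.\<close>

lemma (in prob_space) consistent_with_cond_on_value:
  assumes N [measurable]: "N \<in> measurable M (count_space R)"
    and pos: "\<And>n. n \<in> R \<Longrightarrow> 0 < prob {\<omega> \<in> space M. N \<omega> = n}"
  shows "consistent_with M (distr M (count_space R) N) (cond_on_value M N) N"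
proof -
  have "measure (cond_on_value M N n) (N -` B \<inter> space M) = 1" if "B \<subseteq> R" "n \<in> B" for B n
  proof -
    have n: "n \<in> R"
      using that by auto
    have [measurable]: "N -` B \<inter> space M \<in> sets M"
      using that by (intro measurable_sets[OF N]) auto
    have "{\<omega> \<in> space M. N \<omega> = n} \<inter> (N -` B \<inter> space M) = {\<omega> \<in> space M. N \<omega> = n}"
      using that by auto
    then show ?thesis
      using pos[OF n] by (simp add: cond_on_value_eq_uniform_measure emeasure_eq_measure)
  qed
  then show ?thesis
    unfolding consistent_with_def by (auto simp: measure_distr intro!: AE_I2)
qed

text \<open>The event \<open>{N = m}\<close> may be null here, so the lemma can be applied with
  \<open>m = n - 1\<close> before \<open>n - 1\<close> is known to lie in \<open>R\<close>.\<close>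

lemma (in prob_space) panjer_recursion_integral:
  fixes N :: "'a \<Rightarrow> nat" and c :: "'b \<Rightarrow> real"
  assumes \<Theta>: "\<Theta> \<in> measurable M S" and c: "c \<in> borel_measurable S"
    and N [measurable]: "{\<omega> \<in> space M. N \<omega> = n} \<in> sets M" "{\<omega> \<in> space M. N \<omega> = m} \<in> sets M"
    and rec: "AE \<omega> in M. cond_prob_eq M N n S \<Theta> \<omega> = c (\<Theta> \<omega>) * cond_prob_eq M N m S \<Theta> \<omega>"
  shows "integrable M (\<lambda>\<omega>. c (\<Theta> \<omega>) * indicator {\<omega> \<in> space M. N \<omega> = m} \<omega>)"
    and "(\<integral>\<omega>. c (\<Theta> \<omega>) * indicator {\<omega> \<in> space M. N \<omega> = m} \<omega> \<partial>M) = prob {\<omega> \<in> space M. N \<omega> = n}"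
proof -
  let ?F = "vimage_algebra (space M) \<Theta> S"
  let ?I = "\<lambda>k. indicator {\<omega> \<in> space M. N \<omega> = k} :: 'a \<Rightarrow> real"
  have space: "\<Theta> \<in> space M \<rightarrow> space S"
    using \<Theta> by (auto dest: measurable_space)
  have "subalgebra M ?F"
    using measurable_sets[OF \<Theta>] by (auto simp: subalgebra_def sets_vimage_algebra2[OF space])
  then interpret finite_measure_subalgebra M ?F
    by unfold_locales
  have f [measurable]: "(\<lambda>\<omega>. c (\<Theta> \<omega>)) \<in> borel_measurable ?F"
    using measurable_compose[OF measurable_vimage_algebra1[OF space] c] .
  have int: "integrable M (?I n)" "integrable M (?I m)"
    by (auto intro!: integrable_real_indicator simp: emeasure_eq_measure)
  have fM [measurable]: "(\<lambda>\<omega>. c (\<Theta> \<omega>)) \<in> borel_measurable M"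
    using measurable_compose[OF \<Theta> c] .
  have cond: "cond_prob_eq M N k S \<Theta> = real_cond_exp M ?F (?I k)" for k
    by (simp add: cond_prob_eq_def)
  have int_cond: "integrable M (\<lambda>\<omega>. c (\<Theta> \<omega>) * real_cond_exp M ?F (?I m) \<omega>)"
  proof (rule integrable_cong_AE_imp)
    show "integrable M (real_cond_exp M ?F (?I n))"
      by (rule real_cond_exp_int(1)[OF int(1)])
    show "AE \<omega> in M. real_cond_exp M ?F (?I n) \<omega> = c (\<Theta> \<omega>) * real_cond_exp M ?F (?I m) \<omega>"
      using rec by (simp add: cond)
  qed simp
  show *: "integrable M (\<lambda>\<omega>. c (\<Theta> \<omega>) * ?I m \<omega>)"
    by (rule integrable_mult_real_cond_expD[OF int(2) _ f int_cond]) auto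
  \<comment> \<open>The chain is: pull out the \<Theta>-measurable factor, apply the recursion, then
    use that conditioning preserves the expectation of \<open>?I n\<close>.\<close>
  have "(\<integral>\<omega>. c (\<Theta> \<omega>) * ?I m \<omega> \<partial>M) = (\<integral>\<omega>. c (\<Theta> \<omega>) * real_cond_exp M ?F (?I m) \<omega> \<partial>M)"
    by (rule real_cond_exp_intg(2)[symmetric, OF * f]) auto
  also have "\<dots> = (\<integral>\<omega>. real_cond_exp M ?F (?I n) \<omega> \<partial>M)"
    using rec by (intro integral_cong_AE) (auto simp: cond)
  also have "\<dots> = prob {\<omega> \<in> space M. N \<omega> = n}"
    using real_cond_exp_int(2)[OF int(1)] by simp
  finally show "(\<integral>\<omega>. c (\<Theta> \<omega>) * ?I m \<omega> \<partial>M) = prob {\<omega> \<in> space M. N \<omega> = n}" .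
qed

text \<open>Integrability is asserted alongside the equation, so \<open>C_n\<close> is explicitly a
  genuine expectation and not the default value 0 of the integral of a nonintegrable
  function.\<close>

theorem theorem2p11:
  fixes P :: "'a measure" and N :: "'a \<Rightarrow> nat" and R :: "nat set"
    and \<Theta> :: "'a \<Rightarrow> real ^ 'd" and D :: "(real ^ 'd) set"
    and a b :: "real ^ 'd \<Rightarrow> real"
  assumes "prob_space P"
    and "0 \<in> R"
    and "N \<in> measurable P (count_space R)"
    and "\<And>n. n \<in> R \<Longrightarrow> measure P {\<omega>\<in>space P. N \<omega> = n} > 0"
    and "\<Theta> \<in> measurable P (restrict_space borel D)"
    and "\<exists>K. regular_cond_prob P (distr P (restrict_space borel D) \<Theta>) K \<and>
             consistent_with P (distr P (restrict_space borel D) \<Theta>) K \<Theta>"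
    and "a \<in> borel_measurable (restrict_space borel D)"
    and "b \<in> borel_measurable (restrict_space borel D)"
    and "mixed_panjer_0 P N R (restrict_space borel D) \<Theta> a b"
  shows "regular_cond_prob P (distr P (count_space R) N) (cond_on_value P N) \<and>
         consistent_with P (distr P (count_space R) N) (cond_on_value P N) N \<and>
         (\<forall>n\<in>R - {0}.
            integrable (cond_on_value P N (n - 1)) (\<lambda>\<omega>. a (\<Theta> \<omega>) + b (\<Theta> \<omega>) / real n) \<and>
            measure P {\<omega>\<in>space P. N \<omega> = n} =
              (\<integral>\<omega>. (a (\<Theta> \<omega>) + b (\<Theta> \<omega>) / real n) \<partial>(cond_on_value P N (n - 1))) *
              measure P {\<omega>\<in>space P. N \<omega> = n - 1})"
proof -
  interpret prob_space P
    by fact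
  note N = assms(3) and pos = assms(4) and \<Theta> = assms(5)
  have "integrable (cond_on_value P N (n - 1)) (\<lambda>\<omega>. a (\<Theta> \<omega>) + b (\<Theta> \<omega>) / real n) \<and>
      measure P {\<omega>\<in>space P. N \<omega> = n} =
        (\<integral>\<omega>. (a (\<Theta> \<omega>) + b (\<Theta> \<omega>) / real n) \<partial>(cond_on_value P N (n - 1))) *
        measure P {\<omega>\<in>space P. N \<omega> = n - 1}"
    if n: "n \<in> R - {0}" for n
  proof -
    let ?S = "\<lambda>k. {\<omega> \<in> space P. N \<omega> = k}"
    \<comment> \<open>This must cover \<open>k\<close> outside \<open>R\<close> as well, because
      \<open>n - 1\<close> is not yet known to be in \<open>R\<close>. Intersecting with
      \<open>R\<close> makes \<open>{k}\<close> a set of \<open>count_space R\<close>.\<close>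
    have S: "?S k \<in> sets P" for k
    proof -
      have "?S k = N -` ({k} \<inter> R) \<inter> space P"
        using measurable_space[OF N] by auto
      then show ?thesis
        using measurable_sets[OF N, of "{k} \<inter> R"] by simp
    qed
    have c: "(\<lambda>\<theta>. a \<theta> + b \<theta> / real n) \<in> borel_measurable (restrict_space borel D)"
      using assms(7,8) by measurable
    note recursion = panjer_recursion_integral[OF \<Theta> c S S, of n "n - 1"]
    have rec: "AE \<omega> in P. cond_prob_eq P N n (restrict_space borel D) \<Theta> \<omega> =
        (a (\<Theta> \<omega>) + b (\<Theta> \<omega>) / real n) * cond_prob_eq P N (n - 1) (restrict_space borel D) \<Theta> \<omega>"
      using assms(9) n by (auto simp: mixed_panjer_0_def)
    \<comment> \<open>A gap in \<open>R\<close> just below \<open>n\<close> would propagate through the recursion and force \<open>P(N = n) = 0\<close>.\<close>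
    have "n - 1 \<in> R"
    proof (rule ccontr)
      assume "n - 1 \<notin> R"
      then have "?S (n - 1) = {}"
        using measurable_space[OF N] by fastforce
      then have "prob (?S n) = 0"
        using recursion(2)[OF rec] by simp
      then show False
        using pos n by force
    qed
    then have p: "0 < prob (?S (n - 1))"
      by (rule pos)
    have f: "(\<lambda>\<omega>. a (\<Theta> \<omega>) + b (\<Theta> \<omega>) / real n) \<in> borel_measurable P"
      using measurable_compose[OF \<Theta> c] .
    show ?thesis
      \<comment> \<open>The expectation under the conditional measure is the
        \<open>P\<close>-integral over \<open>{N = n - 1}\<close> divided by
        \<open>P(N = n - 1)\<close>; multiplying by that positive probability leaves the integral
        computed in \<open>recursion\<close>.\<close>
      unfolding cond_on_value_eq_uniform_measure[OF p] integrable_uniform_measure_iff[OF p f]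
        integral_uniform_measure[OF p f]
      using recursion[OF rec] p by simp
  qed
  then show ?thesis
    using regular_cond_prob_cond_on_value[OF N pos] consistent_with_cond_on_value[OF N pos] by blast
qed

end
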